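(* Let $d\ge2$ be an integer and let $R_1(z)=\sum_j(z-\lambda_j)_+$ be the first Riesz-mean of the Laplacian eigenvalues $\lambda_j$ (counted with multiplicity) on $\mathbb{S}^d$. For all $z\geq0$, $$ R_1(z)\leq L_{1,d}^{class}|\mathbb{S}^d|\,(z+z_d)^{\frac d2+1},\qquad z_d=\frac{(2d-1)d}{12}. $$
   Context: $\mathbb{S}^d$ is the round unit sphere in $\mathbb{R}^{d+1}$. The distinct eigenvalues (energy levels) of $-\Delta$ on $\mathbb{S}^d$ are $\lambda_{(l)}=l(l+d-1)$, $l\in\mathbb{N}=\{0,1,2,\dots\}$, with multiplicity $m_{l,d}=\binom{d+l}{l}-\binom{d+l-2}{l-2}$ (a binomial coefficient with negative lower entry being $0$); $a_+=\max(a,0)$. The semiclassical constant is $L_{\gamma,d}^{class}=(4\pi)^{-d/2}\frac{\Gamma(\gamma+1)}{\Gamma(\gamma+1+d/2)}$, so $L_{1,d}^{class}|\mathbb{S}^d|=\frac{4}{(d+2)\,d!}$. *)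

theory Defs
  imports "HOL-Analysis.Analysis"
begin

section \<open>Spectrum of the Laplacian on the round unit sphere of dimension \<open>d\<close>\<close>

text \<open>The library has no Laplace--Beltrami operator. The spectrum of \<open>-\<Delta>\<close> on the sphere is
  entered through its classical description: energy levels together with their multiplicities.\<close>

definition energy_level :: "nat \<Rightarrow> nat \<Rightarrow> real" where
  "energy_level d l = real l * (real l + real d - 1)"

text \<open>The subtrahend is the binomial coefficient of \<open>d + l - 2\<close> over \<open>l - 2\<close>, which is \<open>0\<close> when its
  lower entry is negative; the conditional is needed because subtraction on \<^typ>\<open>nat\<close> truncates.
  The outer subtraction never truncates.\<close>

definition level_mult :: "nat \<Rightarrow> nat \<Rightarrow> nat" where
  "level_mult d l =
     ((d + l) choose l) - (if l < 2 then 0 else (d + l - 2) choose (l - 2))"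

text \<open>The eigenvalues \<open>\<lambda>\<^sub>0 \<le> \<lambda>\<^sub>1 \<le> \<dots>\<close> counted with multiplicity: the indices \<open>j\<close> belonging to
  level \<open>l\<close> are those with
  \<open>\<Sum>k<l. level_mult d k \<le> j < \<Sum>k\<le>l. level_mult d k\<close>.\<close>

definition sphere_eigenvalue :: "nat \<Rightarrow> nat \<Rightarrow> real" where
  "sphere_eigenvalue d j = energy_level d (LEAST l. j < (\<Sum>k\<le>l. level_mult d k))"

text \<open>The series has only finitely many nonzero terms, see \<open>finite_eigenvalues_below\<close>.\<close>

definition riesz_mean_1 :: "nat \<Rightarrow> real \<Rightarrow> real" where
  "riesz_mean_1 d z = (\<Sum>j. max (z - sphere_eigenvalue d j) 0)"

section \<open>Semiclassical constant\<close>

definition L_class :: "real \<Rightarrow> nat \<Rightarrow> real" where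
  "L_class \<gamma> d =
     (4 * pi) powr (- (real d / 2)) * (Gamma (\<gamma> + 1) / Gamma (\<gamma> + 1 + real d / 2))"

text \<open>Surface area of the unit sphere in Euclidean space of dimension \<open>n = d + 1\<close>: the ball of radius
  \<open>r\<close> has volume \<open>unit_ball_vol n * r ^ n\<close>, whose derivative at \<open>r = 1\<close> is \<open>n * unit_ball_vol n\<close>.\<close>

definition sphere_area :: "nat \<Rightarrow> real" where
  "sphere_area d = real (d + 1) * unit_ball_vol (real (d + 1))"

section \<open>Adequacy of the definitions\<close>

lemma level_mult_0 [simp]: "level_mult d 0 = 1"
  by (simp add: level_mult_def)

lemma level_mult_1 [simp]: "level_mult d (Suc 0) = d + 1"
  by (simp add: level_mult_def)

lemma level_mult_Suc_Suc:
  "level_mult d (Suc (Suc k)) = ((d + k) choose (Suc k)) + (Suc (d + k) choose (Suc (Suc k)))"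
  by (simp add: level_mult_def)

lemma of_nat_level_mult:
  "int (level_mult d l) =
     int ((d + l) choose l) - (if l < 2 then 0 else int ((d + l - 2) choose (l - 2)))"
proof (cases l rule: nat.exhaust)
  case (Suc k)
  then show ?thesis by (cases k) (simp_all add: level_mult_def)
qed (simp add: level_mult_def)

lemma level_mult_pos: "d \<ge> 1 \<Longrightarrow> level_mult d l > 0"
proof (cases l rule: nat.exhaust)
  case (Suc k)
  assume "d \<ge> 1"
  then show ?thesis using Suc by (cases k) (simp_all add: level_mult_Suc_Suc zero_less_binomial_iff)
qed simp

lemma energy_level_strict_mono:
  assumes "d \<ge> 1" shows "strict_mono (energy_level d)"
  unfolding strict_mono_Suc_iff using assms by (auto simp: energy_level_def algebra_simps)

lemma level_index:
  assumes d: "d \<ge> 1"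
  shows "(LEAST l. j < (\<Sum>k\<le>l. level_mult d k)) = l \<longleftrightarrow>
         j \<in> {(\<Sum>k<l. level_mult d k)..<(\<Sum>k<Suc l. level_mult d k)}" (is "?L = l \<longleftrightarrow> ?R")
proof -
  let ?P = "\<lambda>l. j < (\<Sum>k\<le>l. level_mult d k)"
  have ge: "(\<Sum>k\<le>l. level_mult d k) \<ge> Suc l" for l
  proof (induction l)
    case (Suc l)
    then show ?case using level_mult_pos[OF d, of "Suc l"] by simp
  qed simp
  have ex: "?P j" using ge[of j] by simp
  show ?thesis
  proof
    assume L: "?L = l"
    have P: "?P l" using LeastI[of ?P, OF ex] L by simp
    have "(\<Sum>k<l. level_mult d k) \<le> j"
    proof (cases l)
      case (Suc m)
      then have "\<not> ?P m" using L not_less_Least[of m ?P] by simp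
      then show ?thesis using Suc by (simp add: lessThan_Suc_atMost)
    qed simp
    with P show ?R by (simp add: lessThan_Suc_atMost del: sum.lessThan_Suc)
  next
    assume R: ?R
    show "?L = l"
    proof (rule Least_equality)
      show "?P l" using R by (simp add: lessThan_Suc_atMost del: sum.lessThan_Suc)
      fix m assume "?P m"
      show "l \<le> m"
      proof (rule ccontr)
        assume "\<not> l \<le> m"
        then have "(\<Sum>k\<le>m. level_mult d k) \<le> (\<Sum>k<l. level_mult d k)"
          by (intro sum_mono2) auto
        with R \<open>?P m\<close> show False by auto
      qed
    qed
  qed
qed

lemma sphere_eigenvalue_eq_iff:
  assumes "d \<ge> 1"
  shows "{j. sphere_eigenvalue d j = energy_level d l} =
         {(\<Sum>k<l. level_mult d k)..<(\<Sum>k<Suc l. level_mult d k)}"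
proof -
  have "sphere_eigenvalue d j = energy_level d l \<longleftrightarrow>
        (LEAST l. j < (\<Sum>k\<le>l. level_mult d k)) = l" for j
    using strict_mono_eq[OF energy_level_strict_mono[OF assms]] by (simp add: sphere_eigenvalue_def)
  then show ?thesis using level_index[OF assms] by blast
qed

lemma mono_sphere_eigenvalue:
  assumes d: "d \<ge> 1" shows "mono (sphere_eigenvalue d)"
proof
  fix i j :: nat assume "i \<le> j"
  let ?L = "\<lambda>j. LEAST l. j < (\<Sum>k\<le>l. level_mult d k)"
  have "j < (\<Sum>k\<le>?L j. level_mult d k)"
    using level_index[OF d, of j "?L j"] by (simp add: lessThan_Suc_atMost del: sum.lessThan_Suc)
  with \<open>i \<le> j\<close> have "?L i \<le> ?L j" by (intro Least_le) simp
  then show "sphere_eigenvalue d i \<le> sphere_eigenvalue d j"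
    using strict_mono_less_eq[OF energy_level_strict_mono[OF d]] by (simp add: sphere_eigenvalue_def)
qed

lemma card_sphere_eigenvalue:
  "d \<ge> 1 \<Longrightarrow> card {j. sphere_eigenvalue d j = energy_level d l} = level_mult d l"
  by (simp add: sphere_eigenvalue_eq_iff)

lemma range_sphere_eigenvalue:
  assumes "d \<ge> 1" shows "range (sphere_eigenvalue d) = range (energy_level d)"
proof
  show "range (sphere_eigenvalue d) \<subseteq> range (energy_level d)"
    by (auto simp: sphere_eigenvalue_def)
  show "range (energy_level d) \<subseteq> range (sphere_eigenvalue d)"
  proof clarify
    fix l
    have "{j. sphere_eigenvalue d j = energy_level d l} \<noteq> {}"
      using card_sphere_eigenvalue[OF assms, of l] level_mult_pos[OF assms, of l]
      by (metis card.empty less_irrefl)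
    then show "energy_level d l \<in> range (sphere_eigenvalue d)"
      by (metis (mono_tags, lifting) Collect_empty_eq rangeI)
  qed
qed

lemma finite_eigenvalues_below:
  assumes d: "d \<ge> 1" shows "finite {j. sphere_eigenvalue d j < z}"
proof -
  have ge: "energy_level d l \<ge> real l * real l" for l
    unfolding energy_level_def using d by (intro mult_left_mono) auto
  have fin: "finite {j. sphere_eigenvalue d j = energy_level d l}" for l
    by (simp only: sphere_eigenvalue_eq_iff[OF d] finite_atLeastLessThan)
  have "{j. sphere_eigenvalue d j < z} \<subseteq>
        (\<Union>l\<le>nat \<lceil>z\<rceil>. {j. sphere_eigenvalue d j = energy_level d l})"
  proof
    fix j assume j: "j \<in> {j. sphere_eigenvalue d j < z}"
    obtain l where l: "sphere_eigenvalue d j = energy_level d l"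
      using sphere_eigenvalue_def by blast
    have "real l \<le> real l * real l" by (cases l) auto
    then have "real l < z" using ge[of l] l j by auto
    then have "l \<le> nat \<lceil>z\<rceil>" by linarith
    with l show "j \<in> (\<Union>l\<le>nat \<lceil>z\<rceil>. {j. sphere_eigenvalue d j = energy_level d l})" by auto
  qed
  then show ?thesis by (rule finite_subset) (use fin in auto)
qed

lemma Gamma_duplication_real:
  fixes x :: real
  assumes "x > 0"
  shows "Gamma x * Gamma (x + 1/2) = 2 powr (1 - 2 * x) * sqrt pi * Gamma (2 * x)"
proof -
  have nn: "complex_of_real x \<notin> \<int>\<^sub>\<le>\<^sub>0" "complex_of_real x + 1/2 \<notin> \<int>\<^sub>\<le>\<^sub>0"
    using assms by (auto elim!: nonpos_Ints_cases simp: complex_eq_iff)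
  have "complex_of_real (Gamma x * Gamma (x + 1/2)) =
        complex_of_real (exp ((1 - 2 * x) * ln 2) * sqrt pi * Gamma (2 * x))"
    using Gamma_legendre_duplication[OF nn]
    by (simp flip: Gamma_complex_of_real exp_of_real)
  then have "Gamma x * Gamma (x + 1/2) = exp ((1 - 2 * x) * ln 2) * sqrt pi * Gamma (2 * x)"
    by (simp only: of_real_eq_iff)
  then show ?thesis by (simp add: powr_def)
qed

lemma L_class_1_sphere_area:
  "L_class 1 d * sphere_area d = 4 / ((real d + 2) * fact d)"
proof -
  let ?a = "Gamma (real d / 2 + 3 / 2)" and ?b = "Gamma (real d / 2 + 2)"
  have G: "?a * ?b = 2 powr (- real d - 2) * sqrt pi * fact (d + 2)"
  proof -
    have "Gamma (2 * (real d / 2 + 3 / 2)) = fact (d + 2)"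
      using Gamma_fact[of "d + 2", where 'a = real] by (simp add: algebra_simps)
    then show ?thesis
      using Gamma_duplication_real[of "real d / 2 + 3 / 2"] by (simp add: algebra_simps)
  qed
  have PQ: "(4 * pi) powr (- (real d / 2)) * pi powr ((real d + 1) / 2) = 2 powr (- real d) * sqrt pi"
  proof -
    have "(4::real) powr (- (real d / 2)) = 2 powr (- real d)"
      using powr_powr[of 2 2 "- (real d / 2)"] by simp
    moreover have "pi powr (- (real d / 2)) * pi powr ((real d + 1) / 2) = sqrt pi"
      by (simp add: powr_half_sqrt add_divide_distrib flip: powr_add)
    ultimately show ?thesis by (simp add: powr_mult)
  qed
  have L: "L_class 1 d = (4 * pi) powr (- (real d / 2)) / ?b"
  proof -
    have "(1::real) + 1 = 2" "(1::real) + 1 + real d / 2 = real d / 2 + 2" by simp_all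
    moreover have "Gamma (2::real) = 1" using Gamma_fact[of 1, where 'a = real] by simp
    ultimately show ?thesis unfolding L_class_def by (simp only: times_divide_eq_right mult_1_right)
  qed
  have A: "sphere_area d = (real d + 1) * (pi powr ((real d + 1) / 2) / ?a)"
  proof -
    have "real (d + 1) / 2 + 1 = real d / 2 + 3 / 2" by (simp add: add_divide_distrib)
    then show ?thesis by (simp add: sphere_area_def unit_ball_vol_def add.commute)
  qed
  have alg: "P / b * (c * (Q / a)) = c * (P * Q) / (a * b)" for a b c P Q :: real
    by (simp add: mult.commute mult.left_commute)
  have "L_class 1 d * sphere_area d = (real d + 1) * (2 powr (- real d) * sqrt pi) / (?a * ?b)"
    unfolding L A alg PQ ..
  also have "\<dots> = 4 * (real d + 1) / fact (d + 2)"
    unfolding G by (simp add: powr_diff)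
  also have "fact (d + 2) = (real d + 2) * ((real d + 1) * fact d)"
    by (simp add: algebra_simps)
  finally have *: "L_class 1 d * sphere_area d =
      4 * (real d + 1) / ((real d + 2) * ((real d + 1) * fact d))" .
  have "4 * x / (y * (x * w)) = 4 / (y * w)" if "x \<noteq> 0" for x y w :: real
    using that by (simp add: mult.left_commute[of y])
  from this[of "real d + 1" "real d + 2" "fact d"] show ?thesis
    unfolding * by linarith
qed

end

theory Submission
  imports Defs
begin

text \<open>Between two consecutive energy levels \<^term>\<open>energy_level d L\<close> and
  \<^term>\<open>energy_level d (Suc L)\<close> the Riesz mean is affine in \<open>z\<close>: it equals \<open>N z - S\<close>, where \<open>N\<close>
  counts the eigenvalues of level at most \<open>L\<close> and \<open>S\<close> is their sum. Both are explicit: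
  \<open>d! N = (2 L + d) (L + 1) \<dots> (L + d - 1)\<close> and \<open>(d + 2) S = d L (L + d) N\<close>
  (lemmas \<open>fact_mult_eigenvalue_count\<close> and \<open>energy_sum\<close>).

  The right-hand side is \<open>C t\<^sup>p\<close> with \<open>C = 4 / ((d + 2) d!)\<close>, \<open>p = d / 2 + 1\<close> and \<open>t = z + z\<^sub>d\<close>,
  which is convex in \<open>t\<close>, so it lies above each of its tangents. With \<open>B = L (L + d) + (d + 2) z\<^sub>d / d\<close>
  the affine function becomes \<open>N (t - d B / (d + 2))\<close>. The tangent of \<open>C t\<^sup>p\<close> at \<open>t = B\<close> vanishes
  at the same point \<open>t = d B / (d + 2)\<close> and has slope \<open>2 B\<^bsup>d/2\<^esup> / d!\<close>. Where the
  affine function is negative there is nothing to prove; elsewhere it suffices to compare the slopes,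
  that is, to show \<open>d! N / 2 \<le> B\<^bsup>d/2\<^esup>\<close> (lemma \<open>eigenvalue_count_le\<close>).

  This last bound is the inequality of arithmetic and geometric means. Pairing the factor \<open>L + i\<close>
  with \<open>L + d - i\<close> gives
  \<open>(d! N / 2)\<^sup>2 = (L (L + d) + d\<^sup>2 / 4) \<Prod>\<^sub>i (L (L + d) + i (d - i))\<close> with \<open>1 \<le> i < d\<close>, a product of
  \<open>d\<close> factors whose mean is exactly \<open>B\<close>; this is where the value of the shift \<open>z\<^sub>d\<close> comes from.\<close>

section \<open>Two elementary inequalities\<close>

text \<open>The inequality of arithmetic and geometric means in the form used below. It follows by
  multiplying the inequalities \<open>x / B \<le> exp (x / B - 1)\<close>, the exponents having sum at most \<open>0\<close>.\<close>

lemma prod_le_power_card_if_sum_le: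
  fixes x :: "'a \<Rightarrow> real"
  assumes nonneg: "\<And>i. i \<in> I \<Longrightarrow> 0 \<le> x i" and B: "0 < B"
    and sum: "(\<Sum>i\<in>I. x i) \<le> real (card I) * B"
  shows "(\<Prod>i\<in>I. x i) \<le> B ^ card I"
proof -
  have "(\<Prod>i\<in>I. x i / B) \<le> (\<Prod>i\<in>I. exp (x i / B - 1))"
  proof (rule prod_mono)
    fix i assume "i \<in> I"
    then show "0 \<le> x i / B \<and> x i / B \<le> exp (x i / B - 1)"
      using nonneg B exp_ge_add_one_self[of "x i / B - 1"] by simp
  qed
  also have "\<dots> \<le> 1"
  proof (cases "finite I")
    case True
    have "(\<Sum>i\<in>I. x i / B - 1) = (\<Sum>i\<in>I. x i) / B - real (card I)"
      by (simp add: sum_subtractf sum_divide_distrib)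
    also have "\<dots> \<le> 0" using sum B by (simp add: field_simps)
    finally show ?thesis using True by (simp flip: exp_sum)
  qed simp
  finally show ?thesis using B by (simp add: prod_dividef)
qed

text \<open>The graph of \<open>t \<mapsto> t\<^sup>p\<close> lies above its tangent at \<open>t = b\<close>. This is Young's inequality for the
  product of \<open>t\<close> and \<open>b\<^bsup>p-1\<^esup>\<close>.\<close>

lemma powr_ge_tangent:
  fixes b t p :: real
  assumes "0 < b" "0 \<le> t" "1 < p"
  shows "b powr (p - 1) * (p * t - (p - 1) * b) \<le> t powr p"
proof -
  define q where "q = p / (p - 1)"
  have q: "1 < q" "1 / p + 1 / q = 1" "(p - 1) * q = p"
    using assms by (simp_all add: q_def field_simps)
  have "t * b powr (p - 1) \<le> t powr p / p + b powr p / q"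
    using Youngs_inequality[of p q t "b powr (p - 1)"] assms q by (simp add: powr_powr)
  then have "p * (t * b powr (p - 1)) \<le> t powr p + (p - 1) * b powr p"
    using assms by (simp add: q_def field_simps)
  moreover have "b powr p = b powr (p - 1) * b"
    using assms powr_add[of b "p - 1" 1] by simp
  ultimately show ?thesis by (simp add: algebra_simps)
qed

section \<open>Number and sum of the lowest eigenvalues\<close>

text \<open>The binomial coefficient subtracted in the multiplicity of level \<open>k + 2\<close> is the leading one
  of level \<open>k\<close>. The sum telescopes, and the leading ones of the last two levels survive.\<close>

lemma sum_level_mult_Suc:
  "(\<Sum>k\<le>Suc L. level_mult d k) = ((d + Suc L) choose d) + ((d + L) choose d)"
proof (induction L)
  case (Suc L)
  have "level_mult d (Suc (Suc L)) + ((d + L) choose d) = (d + Suc (Suc L)) choose d"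
  proof -
    have "(d + L) choose L = (d + L) choose d"
      using binomial_symmetric[of L "d + L"] by simp
    moreover have "(d + Suc (Suc L)) choose (Suc (Suc L)) = (d + Suc (Suc L)) choose d"
      using binomial_symmetric[of "Suc (Suc L)" "d + Suc (Suc L)"] by simp
    ultimately show ?thesis by (simp add: level_mult_Suc_Suc)
  qed
  with Suc show ?case by simp
qed (cases d, simp_all)

lemma fact_mult_choose_eq_pochhammer:
  "fact d * real ((d + L) choose d) = pochhammer (real L + 1) d"
  by (simp add: binomial_gbinomial gbinomial_pochhammer')

lemma fact_mult_eigenvalue_count:
  assumes "d \<ge> 1"
  shows "fact d * real (\<Sum>k\<le>L. level_mult d k)
           = (2 * real L + real d) * pochhammer (real L + 1) (d - 1)"
proof (cases L)
  case 0
  obtain n where "d = Suc n" using assms by (cases d) auto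
  then show ?thesis using 0 by (simp add: pochhammer_fact[symmetric] algebra_simps)
next
  case (Suc K)
  obtain n where n: "d = Suc n" using assms by (cases d) auto
  have "fact d * real (\<Sum>k\<le>L. level_mult d k)
          = pochhammer (real L + 1) d + pochhammer (real K + 1) d"
    unfolding Suc sum_level_mult_Suc
    using fact_mult_choose_eq_pochhammer[of d "Suc K"] fact_mult_choose_eq_pochhammer[of d K]
    by (simp add: distrib_left)
  also have "pochhammer (real L + 1) d = (real L + real d) * pochhammer (real L + 1) (d - 1)"
    by (simp add: n pochhammer_rec' algebra_simps)
  also have "pochhammer (real K + 1) d = real L * pochhammer (real L + 1) (d - 1)"
    by (simp add: n Suc pochhammer_rec algebra_simps)
  finally show ?thesis by (simp add: algebra_simps)
qed

text \<open>Two successive closed forms differ only in their outermost factors; this recursion drives the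
  induction for the sum of the eigenvalues.\<close>

lemma eigenvalue_count_Suc:
  assumes "d \<ge> 1"
  shows "real (\<Sum>k\<le>Suc L. level_mult d k) * (real L + 1) * (2 * real L + real d)
           = real (\<Sum>k\<le>L. level_mult d k) * (real L + real d) * (2 * real L + real d + 2)"
    (is "?N' * ?a * ?b = ?N * ?e * ?f")
proof -
  obtain n where n: "d = Suc n" using assms by (cases d) auto
  let ?P = "pochhammer (real L + 1) (d - 1)" and ?P' = "pochhammer (real L + 2) (d - 1)"
  have N: "fact d * ?N = ?b * ?P"
    using fact_mult_eigenvalue_count[OF assms] .
  have N': "fact d * ?N' = ?f * ?P'"
    using fact_mult_eigenvalue_count[OF assms, of "Suc L"] by (simp add: algebra_simps)
  have P: "?a * ?P' = ?e * ?P"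
    using pochhammer_rec[of "real L + 1" n] pochhammer_rec'[of "real L + 1" n]
    by (simp add: n algebra_simps)
  have "fact d * (?N' * ?a * ?b) = (fact d * ?N') * ?a * ?b" by simp
  also have "\<dots> = ?f * ?b * (?a * ?P')" unfolding N' by simp
  also have "\<dots> = (fact d * ?N) * ?e * ?f" unfolding N P by simp
  finally show ?thesis by simp
qed

lemma energy_sum:
  assumes "d \<ge> 1"
  shows "(real d + 2) * (\<Sum>k\<le>L. real (level_mult d k) * energy_level d k)
           = real d * real L * (real L + real d) * real (\<Sum>k\<le>L. level_mult d k)"
proof (induction L)
  case (Suc L)
  define N N' where "N = real (\<Sum>k\<le>L. level_mult d k)" and "N' = real (\<Sum>k\<le>Suc L. level_mult d k)"
  define l r where "l = real L" and "r = real d"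
  have m: "real (level_mult d (Suc L)) = N' - N" by (simp add: N_def N'_def)
  have e: "energy_level d (Suc L) = (l + 1) * (l + r)"
    by (simp add: energy_level_def l_def r_def algebra_simps)
  have rec: "N' * (l + 1) * (2 * l + r) = N * (l + r) * (2 * l + r + 2)"
    using eigenvalue_count_Suc[OF assms] by (simp only: N_def N'_def l_def r_def)
  have "(r + 2) * (\<Sum>k\<le>Suc L. real (level_mult d k) * energy_level d k)
          = r * l * (l + r) * N + (r + 2) * ((N' - N) * ((l + 1) * (l + r)))"
    using Suc unfolding N_def[symmetric] l_def[symmetric] r_def[symmetric]
    by (simp add: m e distrib_left)
  also have "\<dots> = r * (l + 1) * (l + 1 + r) * N'"
    using rec by algebra
  finally show ?case by (simp add: N'_def l_def r_def add.commute)
qed (simp add: energy_level_def)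

text \<open>The squared closed form is a product of \<open>d\<close> factors whose arithmetic mean is the base on the
  right.\<close>

lemma eigenvalue_count_le:
  assumes "d \<ge> 1"
  shows "fact d * real (\<Sum>k\<le>L. level_mult d k) / 2
           \<le> (real L * (real L + real d) + (real d + 2) * (2 * real d - 1) / 12) powr (real d / 2)"
    (is "?M \<le> ?B powr _")
proof -
  define A where "A = real L * (real L + real d)"
  define P where "P = (\<Prod>i\<in>{1..<d}. real L + real i)"
  \<comment> \<open>The index \<open>0\<close> carries the square of the unpaired factor \<open>L + d / 2\<close>.\<close>
  define x where "x i = A + (if i = 0 then (real d)\<^sup>2 / 4 else real i * (real d - real i))" for i
  have A: "A \<ge> 0" by (simp add: A_def)
  have B: "?B > 0" using A assms by (auto simp flip: A_def intro!: add_nonneg_pos)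
  have split: "{..<d} = insert 0 {1..<d}" using assms by auto
  have M: "?M = (real L + real d / 2) * P"
  proof -
    obtain n where n: "d = Suc n" using assms by (cases d) auto
    have "P = pochhammer (real L + 1) (d - 1)"
      unfolding P_def pochhammer_prod n
      by (rule prod.reindex_bij_witness[of _ Suc "\<lambda>i. i - 1"]) (auto simp: of_nat_diff)
    then show ?thesis using fact_mult_eigenvalue_count[OF assms, of L] by (simp add: field_simps)
  qed
  have "P = (\<Prod>i\<in>{1..<d}. real L + (real d - real i))"
    unfolding P_def by (rule prod.reindex_bij_witness[of _ "\<lambda>i. d - i" "\<lambda>i. d - i"]) auto
  then have "P\<^sup>2 = (\<Prod>i\<in>{1..<d}. (real L + real i) * (real L + (real d - real i)))"
    unfolding prod.distrib power2_eq_square by (simp add: P_def)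
  also have "\<dots> = (\<Prod>i\<in>{1..<d}. x i)"
    by (rule prod.cong) (auto simp: x_def A_def algebra_simps)
  finally have "?M\<^sup>2 = (\<Prod>i<d. x i)"
    unfolding M power_mult_distrib split
    by (simp add: x_def A_def power2_eq_square field_simps)
  also have "\<dots> \<le> ?B ^ card {..<d}"
  proof (rule prod_le_power_card_if_sum_le)
    show "0 \<le> x i" if "i \<in> {..<d}" for i using that A by (auto simp: x_def)
    have sum: "(\<Sum>i<n. real i * (c - real i))
                 = c * (real n * (real n - 1) / 2) - real n * (real n - 1) * (2 * real n - 1) / 6" for n c
      by (induction n) (simp_all add: field_simps)
    have "(\<Sum>i<d. x i) = real d * A + (real d)\<^sup>2 / 4 + (\<Sum>i\<in>{1..<d}. real i * (real d - real i))"
      unfolding split using assms by (simp add: x_def sum.distrib of_nat_diff algebra_simps)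
    also have "(\<Sum>i\<in>{1..<d}. real i * (real d - real i)) = (\<Sum>i<d. real i * (real d - real i))"
      unfolding split by simp
    finally show "(\<Sum>i<d. x i) \<le> real (card {..<d}) * ?B"
      unfolding sum A_def[symmetric] by (simp add: field_simps power2_eq_square)
  qed (rule B)
  finally have "?M \<le> sqrt (?B ^ d)" unfolding card_lessThan by (rule real_le_rsqrt)
  also have "\<dots> = ?B powr (real d / 2)"
    using B by (simp add: powr_half_sqrt[symmetric] powr_powr flip: powr_realpow)
  finally show ?thesis .
qed

section \<open>The Riesz mean between two energy levels\<close>

lemma sum_over_eigenvalues:
  assumes "d \<ge> 1"
  shows "(\<Sum>j<(\<Sum>k<n. level_mult d k). f (sphere_eigenvalue d j))
           = (\<Sum>k<n. of_nat (level_mult d k) * f (energy_level d k))"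
proof (induction n)
  case (Suc n)
  let ?N = "\<Sum>k<n. level_mult d k" and ?N' = "\<Sum>k<Suc n. level_mult d k"
  have "{..<?N'} = {..<?N} \<union> {?N..<?N'}" by auto
  then have "(\<Sum>j<?N'. f (sphere_eigenvalue d j))
      = (\<Sum>j<?N. f (sphere_eigenvalue d j)) + (\<Sum>j\<in>{?N..<?N'}. f (sphere_eigenvalue d j))"
    by (simp only: sum.union_disjoint finite_lessThan finite_atLeastLessThan ivl_disj_int)
  also have "(\<Sum>j\<in>{?N..<?N'}. f (sphere_eigenvalue d j)) = (\<Sum>j\<in>{?N..<?N'}. f (energy_level d n))"
  proof (rule sum.cong[OF refl])
    fix j assume "j \<in> {?N..<?N'}"
    then have "sphere_eigenvalue d j = energy_level d n"
      using sphere_eigenvalue_eq_iff[OF assms, of n] by blast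
    then show "f (sphere_eigenvalue d j) = f (energy_level d n)" by simp
  qed
  finally show ?case using Suc by simp
qed simp

lemma sphere_eigenvalue_less_iff:
  assumes "d \<ge> 1"
  shows "sphere_eigenvalue d j < energy_level d n \<longleftrightarrow> j < (\<Sum>k<n. level_mult d k)"
proof -
  define l where "l = (LEAST l. j < (\<Sum>k\<le>l. level_mult d k))"
  have l: "(\<Sum>k<l. level_mult d k) \<le> j" "j < (\<Sum>k<Suc l. level_mult d k)"
    using level_index[OF assms, of j l] by (simp_all add: l_def)
  have mono: "(\<Sum>k<a. level_mult d k) \<le> (\<Sum>k<b. level_mult d k)" if "a \<le> b" for a b
    using that by (intro sum_mono2) auto
  have "sphere_eigenvalue d j < energy_level d n \<longleftrightarrow> l < n"
    using strict_mono_less[OF energy_level_strict_mono[OF assms]]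
    by (simp add: sphere_eigenvalue_def l_def)
  also have "\<dots> \<longleftrightarrow> j < (\<Sum>k<n. level_mult d k)"
    using l mono[of "Suc l" n] mono[of n l] by (meson Suc_leI leD le_less_trans less_le_trans not_le)
  finally show ?thesis .
qed

lemma riesz_mean_1_eq:
  assumes d: "d \<ge> 1" and z: "energy_level d L \<le> z" "z \<le> energy_level d (Suc L)"
  shows "riesz_mean_1 d z = (\<Sum>k\<le>L. real (level_mult d k) * (z - energy_level d k))"
proof -
  let ?N = "\<Sum>k<Suc L. level_mult d k"
  note less_iff = sphere_eigenvalue_less_iff[OF d, of _ "Suc L"]
  have "riesz_mean_1 d z = (\<Sum>j<?N. max (z - sphere_eigenvalue d j) 0)"
    unfolding riesz_mean_1_def
  proof (rule suminf_finite)
    fix j assume "j \<notin> {..<?N}"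
    then show "max (z - sphere_eigenvalue d j) 0 = 0"
      using less_iff[of j] z(2) by (simp del: sum.lessThan_Suc)
  qed simp
  also have "\<dots> = (\<Sum>k<Suc L. real (level_mult d k) * max (z - energy_level d k) 0)"
    by (rule sum_over_eigenvalues[OF d, of "\<lambda>e. max (z - e) 0"])
  also have "\<dots> = (\<Sum>k<Suc L. real (level_mult d k) * (z - energy_level d k))"
  proof (rule sum.cong[OF refl])
    fix k assume "k \<in> {..<Suc L}"
    then have "energy_level d k \<le> energy_level d L"
      using strict_mono_less_eq[OF energy_level_strict_mono[OF d]] by simp
    then show "real (level_mult d k) * max (z - energy_level d k) 0
                 = real (level_mult d k) * (z - energy_level d k)"
      using z(1) by simp
  qed
  finally show ?thesis by (simp only: lessThan_Suc_atMost)
qed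

lemma ex_energy_level_interval:
  assumes d: "d \<ge> 1" and "z \<ge> 0"
  shows "\<exists>L. energy_level d L \<le> z \<and> z \<le> energy_level d (Suc L)"
proof -
  define n where "n = (LEAST n. z < energy_level d n)"
  obtain m :: nat where m: "z < real m" using reals_Archimedean2 by blast
  have "z < energy_level d m"
  proof -
    have "m > 0" using m \<open>z \<ge> 0\<close> by (cases m) auto
    then have "real m * 1 \<le> energy_level d m"
      unfolding energy_level_def using d by (intro mult_left_mono) auto
    with m show ?thesis by simp
  qed
  then have n: "z < energy_level d n" unfolding n_def by (rule LeastI)
  then obtain L where L: "n = Suc L" using \<open>z \<ge> 0\<close> by (cases n) (auto simp: energy_level_def)
  then have "\<not> z < energy_level d L" unfolding n_def by (intro not_less_Least) simp
  with n L show ?thesis by (intro exI[of _ L]) simp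
qed

section \<open>The semiclassical bound\<close>

theorem theorem4p1p4:
  fixes d :: nat and z :: real
  assumes "d \<ge> 2" and "z \<ge> 0"
  shows "riesz_mean_1 d z
           \<le> L_class 1 d * sphere_area d
               * (z + (2 * real d - 1) * real d / 12) powr (real d / 2 + 1)"
proof -
  have d: "d \<ge> 1" using assms by simp
  obtain L where L: "energy_level d L \<le> z" "z \<le> energy_level d (Suc L)"
    using ex_energy_level_interval[OF d \<open>z \<ge> 0\<close>] by blast
  define N where "N = real (\<Sum>k\<le>L. level_mult d k)"
  define B where "B = real L * (real L + real d) + (real d + 2) * (2 * real d - 1) / 12"
  define t where "t = z + (2 * real d - 1) * real d / 12"
  define s where "s = (real d + 2) * t - real d * B"
  have t: "t \<ge> 0" using assms by (simp add: t_def)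
  have B: "B > 0" using d by (auto simp: B_def intro!: add_nonneg_pos)
  have "riesz_mean_1 d z = N * z - (\<Sum>k\<le>L. real (level_mult d k) * energy_level d k)"
    unfolding riesz_mean_1_eq[OF d L] N_def
    by (simp add: right_diff_distrib sum_subtractf sum_distrib_right)
  then have "(real d + 2) * riesz_mean_1 d z
               = (real d + 2) * N * z - real d * real L * (real L + real d) * N"
    using energy_sum[OF d, of L] by (simp add: N_def right_diff_distrib)
  also have "\<dots> = N * s"
    by (simp add: s_def t_def B_def field_simps)
  finally have R: "(real d + 2) * riesz_mean_1 d z = N * s" .
  \<comment> \<open>The sign of \<open>s\<close> tells on which side of the common zero of affine function and tangent \<open>z\<close> lies.\<close>
  have "fact d * (N * s) \<le> 4 * t powr (real d / 2 + 1)"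
  proof (cases "s \<ge> 0")
    case True
    have "fact d * N / 2 * s \<le> B powr (real d / 2) * s"
      using eigenvalue_count_le[OF d, of L] True unfolding N_def B_def by (rule mult_right_mono)
    also have "\<dots> \<le> 2 * t powr (real d / 2 + 1)"
      using powr_ge_tangent[of B t "real d / 2 + 1"] B t d by (simp add: s_def field_simps)
    finally show ?thesis by simp
  next
    case False
    moreover have "N \<ge> 0" unfolding N_def by (rule of_nat_0_le_iff)
    ultimately have "fact d * (N * s) \<le> 0"
      by (intro mult_nonneg_nonpos) auto
    also have "0 \<le> 4 * t powr (real d / 2 + 1)" by simp
    finally show ?thesis .
  qed
  then have "fact d * ((real d + 2) * riesz_mean_1 d z) \<le> 4 * t powr (real d / 2 + 1)"
    by (simp only: R)
  then have "riesz_mean_1 d z \<le> 4 / ((real d + 2) * fact d) * t powr (real d / 2 + 1)"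
    by (simp add: pos_le_divide_eq add_pos_pos mult_ac)
  then show ?thesis by (simp add: L_class_1_sphere_area t_def)
qed

end
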